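(* Let $I$ be a finite index set, let $f,g:\mathbb{R}^n\to\mathbb{R}$ and $h_i:\mathbb{R}^n\to\mathbb{R}$ ($i\in I$) be functions, and let $X=\{x\in\mathbb{R}^n : h_i(x)\le 0 \ \ \forall i\in I\}$. Assume that $f$ is convex and non-negative on $X$, that $g$ is concave and positive on $X$, that $X$ is closed and convex, and that the optimal value of the fractional program $$\text{(FP)}\qquad \min_{x\in X}\ \frac{f(x)}{g(x)}$$ is attained. Consider the two problems $$\text{(Schaible-FP)}\qquad \min_{t>0,\ y\in\mathbb{R}^n}\ \left\{\, t f\!\left(\frac{y}{t}\right) \ :\ t\, g\!\left(\frac{y}{t}\right)\ge 1,\quad t\, h_i\!\left(\frac{y}{t}\right)\le 0\ \ \forall i\in I \right\}$$ and $$\text{(P-FP)}\qquad \max_{\alpha\ge 0}\ \left\{\, \alpha \ :\ \min_{x\in X}\{f(x)-\alpha g(x)\}\ge 0 \right\}.$$ Then (Schaible-FP) and (P-FP) are dual to each other (in the "primal worst equals dual best" sense described in the context), and strong duality holds, i.e. the optimal values of (Schaible-FP) and (P-FP) are equal.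
   Context: The condition $\min_{x\in X}\{f(x)-\alpha g(x)\}\ge 0$ in (P-FP) means that $f(x)-\alpha g(x)\ge 0$ for all $x\in X$. Sense of duality. Consider a robust linear program in the variable $\alpha$ in which $x\in X$ plays the role of the uncertain parameter, $\max_{\alpha\ge 0}\{\alpha : f(x)-\alpha g(x)\ge 0\ \ \forall x\in X\}$. For a fixed $x$, the linear program $\max_{\alpha\ge 0}\{\alpha : f(x)-\alpha g(x)\ge 0\}$ has the linear programming dual $\min_{t\ge 0}\{t f(x) : t g(x)\ge 1\}$. The optimistic counterpart of this dual is obtained by making $x$ an additional optimization variable: $\min_{t\ge 0,\ x\in X}\{t f(x) : t g(x)\ge 1\}$. The robust linear program and the optimistic counterpart of its dual are called dual to each other. Two given problems are called dual to each other in this sense if one of them is equivalent to such a robust linear program and the other is equivalent to the corresponding optimistic counterpart, where equivalence allows the change of variables $y=tx$. Strong duality means that the optimal values of the two problems coincide. *)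

theory Defs
  imports "HOL-Analysis.Analysis"
begin

datatype sense = Minimize | Maximize

record 'v opt_problem =
  sense :: sense
  feasible :: "'v set"
  objective :: "'v \<Rightarrow> real"

text \<open>
  Optimal values live in the extended reals, so that they exist for every problem. Infeasible
  minimization (maximization) problems have the value \<open>\<infinity>\<close> (\<open>-\<infinity>\<close>). Attainment is a separate notion.
\<close>

definition optimal_value :: "'v opt_problem \<Rightarrow> ereal" where
  "optimal_value P =
     (case sense P of
        Minimize \<Rightarrow> (INF z\<in>feasible P. ereal (objective P z))
      | Maximize \<Rightarrow> (SUP z\<in>feasible P. ereal (objective P z)))"

definition attained :: "'v opt_problem \<Rightarrow> bool" where
  "attained P \<longleftrightarrow> (\<exists>z\<in>feasible P. ereal (objective P z) = optimal_value P)"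

definition equivalent_via :: "('v \<Rightarrow> 'w) \<Rightarrow> 'v opt_problem \<Rightarrow> 'w opt_problem \<Rightarrow> bool" where
  "equivalent_via \<phi> P Q \<longleftrightarrow>
     sense P = sense Q \<and>
     bij_betw \<phi> (feasible P) (feasible Q) \<and>
     (\<forall>z\<in>feasible P. objective Q (\<phi> z) = objective P z)"


text \<open>
  The linear program in the single variable \<open>\<alpha>\<close> for a fixed value \<open>x\<close> of the uncertain parameter,
  and its linear programming dual in the single variable \<open>t\<close>.
\<close>

definition scenario_lp :: "('a \<Rightarrow> real) \<Rightarrow> ('a \<Rightarrow> real) \<Rightarrow> 'a \<Rightarrow> real opt_problem" where
  "scenario_lp f g x =
     \<lparr> sense = Maximize,
       feasible = {\<alpha>. \<alpha> \<ge> 0 \<and> f x - \<alpha> * g x \<ge> 0},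
       objective = (\<lambda>\<alpha>. \<alpha>) \<rparr>"

definition scenario_dual :: "('a \<Rightarrow> real) \<Rightarrow> ('a \<Rightarrow> real) \<Rightarrow> 'a \<Rightarrow> real opt_problem" where
  "scenario_dual f g x =
     \<lparr> sense = Minimize,
       feasible = {t. t \<ge> 0 \<and> t * g x \<ge> 1},
       objective = (\<lambda>t. t * f x) \<rparr>"

text \<open>
  In the robust program \<open>\<alpha>\<close> has to be feasible for all scenarios; the condition \<open>\<alpha> \<ge> 0\<close> is stated
  separately because it does not follow from the scenario constraints when \<open>X\<close> is empty.
  In the optimistic counterpart of the dual the scenario \<open>x\<close> is itself a decision variable.
\<close>

definition robust_lp :: "('a \<Rightarrow> real) \<Rightarrow> ('a \<Rightarrow> real) \<Rightarrow> 'a set \<Rightarrow> real opt_problem" where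
  "robust_lp f g X =
     \<lparr> sense = Maximize,
       feasible = {\<alpha>. \<alpha> \<ge> 0 \<and> (\<forall>x\<in>X. \<alpha> \<in> feasible (scenario_lp f g x))},
       objective = (\<lambda>\<alpha>. \<alpha>) \<rparr>"

definition optimistic_dual ::
  "('a \<Rightarrow> real) \<Rightarrow> ('a \<Rightarrow> real) \<Rightarrow> 'a set \<Rightarrow> (real \<times> 'a) opt_problem" where
  "optimistic_dual f g X =
     \<lparr> sense = Minimize,
       feasible = {(t, x). x \<in> X \<and> t \<in> feasible (scenario_dual f g x)},
       objective = (\<lambda>(t, x). objective (scenario_dual f g x) t) \<rparr>"

text \<open>
  \<open>P\<close> and \<open>D\<close> are dual to each other in the sense ``primal worst equals dual best'', with respect to
  the data \<open>f\<close>, \<open>g\<close>, \<open>X\<close>: up to equivalence, \<open>P\<close> is the robust linear program and \<open>D\<close> the optimistic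
  counterpart of its dual. The only admissible changes of variables are the trivial one and \<open>y = t x\<close>.
\<close>

definition primal_worst_dual_best ::
  "('a \<Rightarrow> real) \<Rightarrow> ('a \<Rightarrow> real) \<Rightarrow> 'a set \<Rightarrow>
   real opt_problem \<Rightarrow> (real \<times> 'a::real_vector) opt_problem \<Rightarrow> bool" where
  "primal_worst_dual_best f g X P D \<longleftrightarrow>
     equivalent_via id (robust_lp f g X) P \<and>
     (\<exists>\<phi>\<in>{id, \<lambda>(t, x). (t, t *\<^sub>R x)}. equivalent_via \<phi> (optimistic_dual f g X) D)"


definition FP :: "('a \<Rightarrow> real) \<Rightarrow> ('a \<Rightarrow> real) \<Rightarrow> 'a set \<Rightarrow> 'a opt_problem" where
  "FP f g X =
     \<lparr> sense = Minimize, feasible = X, objective = (\<lambda>x. f x / g x) \<rparr>"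

definition Schaible_FP ::
  "('a::real_vector \<Rightarrow> real) \<Rightarrow> ('a \<Rightarrow> real) \<Rightarrow> 'i set \<Rightarrow> ('i \<Rightarrow> 'a \<Rightarrow> real) \<Rightarrow>
   (real \<times> 'a) opt_problem" where
  "Schaible_FP f g I h =
     \<lparr> sense = Minimize,
       feasible = {(t, y). t > 0 \<and> t * g (y /\<^sub>R t) \<ge> 1 \<and> (\<forall>i\<in>I. t * h i (y /\<^sub>R t) \<le> 0)},
       objective = (\<lambda>(t, y). t * f (y /\<^sub>R t)) \<rparr>"

text \<open>The constraint \<open>min\<^sub>x (f x - \<alpha> g x) \<ge> 0\<close> is read as a statement about all \<open>x \<in> X\<close>.\<close>

definition P_FP :: "('a \<Rightarrow> real) \<Rightarrow> ('a \<Rightarrow> real) \<Rightarrow> 'a set \<Rightarrow> real opt_problem" where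
  "P_FP f g X =
     \<lparr> sense = Maximize,
       feasible = {\<alpha>. \<alpha> \<ge> 0 \<and> (\<forall>x\<in>X. f x - \<alpha> * g x \<ge> 0)},
       objective = (\<lambda>\<alpha>. \<alpha>) \<rparr>"

end

theory Submission
  imports Defs
begin

text \<open>
  Both problems have the optimal value of the fractional program, that is the minimal ratio
  \<open>m = f x\<^sub>0 / g x\<^sub>0\<close>, where \<open>x\<^sub>0\<close> is a minimizer.

  Duality: the parametric problem is literally the robust linear program. Substituting \<open>y = t x\<close>
  turns the optimistic dual into Schaible's problem, because the constraint \<open>t g(x) \<ge> 1\<close> already
  excludes \<open>t = 0\<close>; for \<open>t > 0\<close> the substitution is invertible, and multiplying \<open>h\<^sub>i(x) \<le> 0\<close> by \<open>t\<close>
  does not change it (\<open>optimistic_dual_equivalent_Schaible_FP\<close>).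

  Strong duality: equivalent problems have equal values (\<open>optimal_value_equivalent_via\<close>), so it
  suffices to compare the robust program with the optimistic dual. Linear programming weak duality in
  each scenario gives one inequality (\<open>robust_lp_le_optimistic_dual\<close>). The other follows from a pair
  of feasible points with the same objective value (\<open>strong_duality\<close>): \<open>\<alpha> = m\<close> is robustly
  feasible since \<open>m\<close> is a lower bound of all ratios, and \<open>(1 / g x\<^sub>0, x\<^sub>0)\<close> is feasible for the
  optimistic dual with the value \<open>f x\<^sub>0 / g x\<^sub>0 = m\<close>.
\<close>

lemma optimal_value_equivalent_via:
  assumes "equivalent_via \<phi> P Q"
  shows "optimal_value P = optimal_value Q"
proof -
  have "feasible Q = \<phi> ` feasible P"
    using assms by (simp add: equivalent_via_def bij_betw_def)
  moreover have "sense P = sense Q" "\<forall>z\<in>feasible P. objective Q (\<phi> z) = objective P z"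
    using assms by (simp_all add: equivalent_via_def)
  ultimately have "(\<lambda>z. ereal (objective Q z)) ` feasible Q = (\<lambda>z. ereal (objective P z)) ` feasible P"
    by (simp add: image_image)
  with \<open>sense P = sense Q\<close> show ?thesis
    by (simp only: optimal_value_def)
qed

lemma robust_lp_eq_P_FP: "robust_lp f g X = P_FP f g X"
  by (auto simp: robust_lp_def P_FP_def scenario_lp_def)

lemma optimistic_dual_equivalent_Schaible_FP:
  fixes f g :: "'a::real_vector \<Rightarrow> real"
  assumes "X = {x. \<forall>i\<in>I. h i x \<le> 0}"
  shows "equivalent_via (\<lambda>(t, x). (t, t *\<^sub>R x)) (optimistic_dual f g X) (Schaible_FP f g I h)"
proof -
  let ?\<phi> = "\<lambda>(t, x). (t, t *\<^sub>R x) :: real \<times> 'a"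
  let ?P = "optimistic_dual f g X" and ?Q = "Schaible_FP f g I h"
  have P: "(t, x) \<in> feasible ?P \<longleftrightarrow> t > 0 \<and> t * g x \<ge> 1 \<and> (\<forall>i\<in>I. h i x \<le> 0)" for t x
    using assms by (cases "t = 0") (auto simp: optimistic_dual_def scenario_dual_def)
  have Q: "(t, y) \<in> feasible ?Q \<longleftrightarrow> t > 0 \<and> t * g (y /\<^sub>R t) \<ge> 1 \<and> (\<forall>i\<in>I. h i (y /\<^sub>R t) \<le> 0)"
    for t y
    by (auto simp: Schaible_FP_def mult_le_0_iff)
  have "bij_betw ?\<phi> (feasible ?P) (feasible ?Q)"
    by (rule bij_betw_byWitness[where f' = "\<lambda>(t, y). (t, y /\<^sub>R t)"]) (auto simp: P Q)
  moreover have "\<forall>z\<in>feasible ?P. objective ?Q (?\<phi> z) = objective ?P z"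
  proof (clarify)
    fix t x assume "(t, x) \<in> feasible ?P"
    then have "t > 0" by (simp add: P)
    then show "objective ?Q (t, t *\<^sub>R x) = objective ?P (t, x)"
      by (simp add: Schaible_FP_def optimistic_dual_def scenario_dual_def)
  qed
  ultimately show ?thesis
    by (simp add: equivalent_via_def optimistic_dual_def Schaible_FP_def)
qed

text \<open>
  Weak duality of the scenario linear programs, applied at the scenario \<open>x\<close> that the optimistic dual
  has selected: the robust solution is feasible for every scenario, hence for this one.
\<close>

lemma robust_lp_le_optimistic_dual:
  assumes "\<alpha> \<in> feasible (robust_lp f g X)" and "(t, x) \<in> feasible (optimistic_dual f g X)"
  shows "\<alpha> \<le> t * f x"
proof -
  have \<alpha>: "\<alpha> \<ge> 0" "\<alpha> * g x \<le> f x" and t: "t \<ge> 0" "t * g x \<ge> 1"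
    using assms by (auto simp: robust_lp_def optimistic_dual_def scenario_lp_def scenario_dual_def)
  have "\<alpha> \<le> \<alpha> * (t * g x)"
    using mult_left_mono[OF t(2) \<alpha>(1)] by simp
  also have "\<dots> = t * (\<alpha> * g x)"
    by (simp add: mult_ac)
  also have "\<dots> \<le> t * f x"
    using \<alpha>(2) t(1) by (rule mult_left_mono)
  finally show ?thesis .
qed

lemma attained_FP_minimizer:
  assumes "attained (FP f g X)"
  obtains x\<^sub>0 where "x\<^sub>0 \<in> X" and "\<And>x. x \<in> X \<Longrightarrow> f x\<^sub>0 / g x\<^sub>0 \<le> f x / g x"
proof -
  obtain x\<^sub>0 where x\<^sub>0: "x\<^sub>0 \<in> X" "ereal (f x\<^sub>0 / g x\<^sub>0) = (INF x\<in>X. ereal (f x / g x))"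
    using assms by (auto simp: attained_def FP_def optimal_value_def)
  have "f x\<^sub>0 / g x\<^sub>0 \<le> f x / g x" if "x \<in> X" for x
    using INF_lower[OF that, of "\<lambda>x. ereal (f x / g x)"] unfolding x\<^sub>0(2)[symmetric] by simp
  with x\<^sub>0(1) show thesis by (rule that)
qed

text \<open>
  The minimal ratio and the reciprocal of \<open>g\<close> at a minimizer form a primal-dual pair with equal
  objective values, so weak duality certifies that both are optimal.
\<close>

lemma strong_duality:
  assumes f_nonneg: "\<And>x. x \<in> X \<Longrightarrow> f x \<ge> 0"
    and g_pos: "\<And>x. x \<in> X \<Longrightarrow> g x > 0"
    and "attained (FP f g X)"
  shows "optimal_value (optimistic_dual f g X) = optimal_value (robust_lp f g X)"
proof -
  let ?P = "robust_lp f g X" and ?D = "optimistic_dual f g X"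
  obtain x\<^sub>0 where "x\<^sub>0 \<in> X" and min: "\<And>x. x \<in> X \<Longrightarrow> f x\<^sub>0 / g x\<^sub>0 \<le> f x / g x"
    using attained_FP_minimizer[OF assms(3)] by blast
  define m where "m = f x\<^sub>0 / g x\<^sub>0"
  have "m \<ge> 0"
    using f_nonneg g_pos \<open>x\<^sub>0 \<in> X\<close> by (simp add: m_def less_imp_le)
  moreover have "m * g x \<le> f x" if "x \<in> X" for x
    using min[OF that] g_pos[OF that] by (simp add: m_def pos_le_divide_eq)
  ultimately have P_m: "m \<in> feasible ?P"
    by (simp add: robust_lp_def scenario_lp_def)
  have D_m: "(1 / g x\<^sub>0, x\<^sub>0) \<in> feasible ?D"
    using g_pos[OF \<open>x\<^sub>0 \<in> X\<close>] \<open>x\<^sub>0 \<in> X\<close> by (simp add: optimistic_dual_def scenario_dual_def)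
  have obj_D: "objective ?D = (\<lambda>(t, x). t * f x)" and obj_P: "objective ?P = (\<lambda>\<alpha>. \<alpha>)"
    by (simp_all add: optimistic_dual_def scenario_dual_def robust_lp_def)
  have "(INF z\<in>feasible ?D. ereal (objective ?D z)) = ereal m"
  proof (rule antisym)
    show "(INF z\<in>feasible ?D. ereal (objective ?D z)) \<le> ereal m"
      by (rule INF_lower2[OF D_m]) (simp add: obj_D m_def)
    show "ereal m \<le> (INF z\<in>feasible ?D. ereal (objective ?D z))"
      using robust_lp_le_optimistic_dual[OF P_m] by (auto intro!: INF_greatest simp: obj_D)
  qed
  moreover have "(SUP \<alpha>\<in>feasible ?P. ereal (objective ?P \<alpha>)) = ereal m"
  proof (rule antisym)
    show "(SUP \<alpha>\<in>feasible ?P. ereal (objective ?P \<alpha>)) \<le> ereal m"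
      using robust_lp_le_optimistic_dual[OF _ D_m] by (auto intro!: SUP_least simp: obj_P m_def)
    show "ereal m \<le> (SUP \<alpha>\<in>feasible ?P. ereal (objective ?P \<alpha>))"
      by (rule SUP_upper2[OF P_m]) (simp add: obj_P)
  qed
  moreover have "sense ?D = Minimize" "sense ?P = Maximize"
    by (simp_all add: optimistic_dual_def robust_lp_def)
  ultimately show ?thesis
    by (simp add: optimal_value_def)
qed

theorem theorem2p1:
  fixes I :: "'i set"
    and f g :: "real ^ 'n \<Rightarrow> real"
    and h :: "'i \<Rightarrow> real ^ 'n \<Rightarrow> real"
    and X :: "(real ^ 'n) set"
  assumes "finite I"
    and "X = {x. \<forall>i\<in>I. h i x \<le> 0}"
    and "convex_on X f"
    and "\<And>x. x \<in> X \<Longrightarrow> f x \<ge> 0"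
    and "concave_on X g"
    and "\<And>x. x \<in> X \<Longrightarrow> g x > 0"
    and "closed X"
    and "convex X"
    and "attained (FP f g X)"
  shows "primal_worst_dual_best f g X (P_FP f g X) (Schaible_FP f g I h)
    \<and> optimal_value (Schaible_FP f g I h) = optimal_value (P_FP f g X)"
proof
  note equiv = optimistic_dual_equivalent_Schaible_FP[OF assms(2), of f g]
  have "equivalent_via id (robust_lp f g X) (P_FP f g X)"
    by (simp add: equivalent_via_def robust_lp_eq_P_FP)
  with equiv show "primal_worst_dual_best f g X (P_FP f g X) (Schaible_FP f g I h)"
    unfolding primal_worst_dual_best_def by blast
  have "optimal_value (Schaible_FP f g I h) = optimal_value (optimistic_dual f g X)"
    using optimal_value_equivalent_via[OF equiv] by simp
  also have "\<dots> = optimal_value (P_FP f g X)"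
    using strong_duality[of X f g] assms(4,6,9) by (simp add: robust_lp_eq_P_FP)
  finally show "optimal_value (Schaible_FP f g I h) = optimal_value (P_FP f g X)" .
qed

end
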